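(* Let $q$ be an odd prime power, $d\ge 2$, and let $Q$ be a nondegenerate quadratic form on $\mathbb F_q^d$. Let $P\subseteq\mathbb F_q^d$ be nonempty, let $\mathcal S$ be a nonempty family of distinct $Q$-spheres, put $n=|P|$, $s=|\mathcal S|$, and $$\mu=1-\frac{I(P,\mathcal S)}{|P||\mathcal S|}.$$ (a) Let $0<\theta<\frac1{d+2}$ and suppose $\mu<\theta$. Then there are an affine subspace $L\subseteq\mathbb F_q^{d+1}$ of dimension at most $d$ and subsets $P_0\subseteq P$, $\mathcal S_0\subseteq\mathcal S$ such that $$P_0\subseteq B(L),\quad |P_0|\ge\bigl(1-(d+1)\theta\bigr)n,\qquad \mathcal S_0\subseteq\mathcal S(L),\quad |\mathcal S_0|\ge\Bigl(1-\frac{\mu}{\theta}\Bigr)s.$$ In particular, every point of $P_0$ lies on every sphere of $\mathcal S_0$, and the retained configuration lies in an explicit rank-$r$ model with $r=\dim L$: there are $c_0\in\mathbb F_q^d$, $r_0\in\mathbb F_q$, an $r$-dimensional linear subspace $W\le\mathbb F_q^d$, a linear functional $\beta:W\to\mathbb F_q$ and $z\in\mathbb F_q^d$ with $\langle z,w\rangle_Q=-\beta(w)$ for all $w\in W$, such that $$\mathcal S(L)=\Bigl\{S_Q\bigl(c_0+\tfrac w2,\ r_0+\beta(w)+\langle c_0,w\rangle_Q+\tfrac14Q(w)\bigr):w\in W\Bigr\},\qquad B(L)=S_Q(c_0,r_0)\cap(z+W^{\perp_Q}).$$ (b) If $$0<\mu<\frac{d+1}{(d+2)^2}\qquad\text{and}\qquad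 \delta=\sqrt{(d+1)\mu},$$ then $L$, $P_0$, $\mathcal S_0$ (with $\dim L\le d$, $P_0\subseteq P\cap B(L)$, $\mathcal S_0\subseteq\mathcal S\cap\mathcal S(L)$) may be chosen so that $$|P_0|\ge(1-\delta)n,\qquad |\mathcal S_0|\ge(1-\delta)s.$$ For $\mu=0$ the same conclusion holds with $P_0=P$, $\mathcal S_0=\mathcal S$ and $\delta=0$.
   Context: Put $\langle x,y\rangle_Q=\frac{Q(x+y)-Q(x)-Q(y)}2$ and $W^{\perp_Q}=\{x:\langle x,w\rangle_Q=0\ \forall w\in W\}$. For $c\in\mathbb F_q^d$, $r\in\mathbb F_q$ the $Q$-sphere is $S_Q(c,r)=\{x\in\mathbb F_q^d:Q(x-c)=r\}$ (radius zero allowed). Spheres are parametrized by pairs $(c,r)$; distinct spheres means distinct parameter pairs. $I(P,\mathcal S)=|\{(p,S)\in P\times\mathcal S:p\in S\}|$. The lift of a sphere is $\Phi(S_Q(c,r))=(2c,r-Q(c))\in\mathbb F_q^{d+1}$ (a bijection from spheres onto $\mathbb F_q^{d+1}$). For $x\in\mathbb F_q^d$ and $y=(u,a)\in\mathbb F_q^d\times\mathbb F_q$ put $\Lambda_x(y)=Q(x)-\langle x,u\rangle_Q-a$, so that $x\in S\iff\Lambda_x(\Phi(S))=0$. For a (nonempty) affine subspace $L\subseteq\mathbb F_q^{d+1}$ put $$\mathcal S(L)=\Phi^{-1}(L),\qquad B(L)=\{x\in\mathbb F_q^d:\Lambda_x(y)=0\text{ for every }y\in L\}.$$ *)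

theory Defs
  imports "HOL-Analysis.Analysis"
begin

definition polar :: "('a::field ^ 'n \<Rightarrow> 'a) \<Rightarrow> 'a ^ 'n \<Rightarrow> 'a ^ 'n \<Rightarrow> 'a" where
  "polar Q x y = (Q (x + y) - Q x - Q y) / 2"

(* Halving in polar is harmless because 2 is nonzero in every field where these notions are used. *)
definition quadratic_form :: "('a::field ^ 'n \<Rightarrow> 'a) \<Rightarrow> bool" where
  "quadratic_form Q \<longleftrightarrow>
     (\<forall>c x. Q (c *s x) = c\<^sup>2 * Q x) \<and>
     (\<forall>y. Vector_Spaces.linear (*s) (*) (\<lambda>x. polar Q x y)) \<and>
     (\<forall>x. Vector_Spaces.linear (*s) (*) (\<lambda>y. polar Q x y))"

definition nondegenerate :: "('a::field ^ 'n \<Rightarrow> 'a) \<Rightarrow> bool" where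
  "nondegenerate Q \<longleftrightarrow> (\<forall>x. (\<forall>y. polar Q x y = 0) \<longrightarrow> x = 0)"

definition perp :: "('a::field ^ 'n \<Rightarrow> 'a) \<Rightarrow> ('a ^ 'n) set \<Rightarrow> ('a ^ 'n) set" where
  "perp Q W = {x. \<forall>w\<in>W. polar Q x w = 0}"

(* A sphere is represented by its parameter pair (c, r), so different pairs count as
   distinct spheres even when their point sets coincide. *)
type_synonym ('a, 'n) sphere_param = "('a ^ 'n) \<times> 'a"

fun sphere_points :: "('a::field ^ 'n \<Rightarrow> 'a) \<Rightarrow> ('a, 'n) sphere_param \<Rightarrow> ('a ^ 'n) set" where
  "sphere_points Q (c, r) = {x. Q (x - c) = r}"

definition incidences ::
  "('a::field ^ 'n \<Rightarrow> 'a) \<Rightarrow> ('a ^ 'n) set \<Rightarrow> ('a, 'n) sphere_param set \<Rightarrow> nat" where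
  "incidences Q P S = card {(p, \<sigma>) \<in> P \<times> S. p \<in> sphere_points Q \<sigma>}"

fun sphere_lift :: "('a::field ^ 'n \<Rightarrow> 'a) \<Rightarrow> ('a, 'n) sphere_param \<Rightarrow> ('a ^ 'n) \<times> 'a" where
  "sphere_lift Q (c, r) = (2 *s c, r - Q c)"

fun lift_form :: "('a::field ^ 'n \<Rightarrow> 'a) \<Rightarrow> 'a ^ 'n \<Rightarrow> ('a ^ 'n) \<times> 'a \<Rightarrow> 'a" where
  "lift_form Q x (u, a) = Q x - polar Q x u - a"

(* The (d+1)-dimensional space of lifts is ('a ^ 'n) \<times> 'a with componentwise scalar
   multiplication; its linear algebra is available with the prefix lifted.p. *)
interpretation lifted: finite_dimensional_vector_space_prod
  "(*s) :: 'a::field \<Rightarrow> 'a ^ 'n \<Rightarrow> 'a ^ 'n" "(*) :: 'a \<Rightarrow> 'a \<Rightarrow> 'a" "cart_basis" "{1}"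
  ..

definition affine_subspace :: "(('a::field ^ 'n) \<times> 'a) set \<Rightarrow> bool" where
  "affine_subspace L \<longleftrightarrow> (\<exists>y V. lifted.p.subspace V \<and> L = (+) y ` V)"

definition affine_dim :: "(('a::field ^ 'n) \<times> 'a) set \<Rightarrow> nat" where
  "affine_dim L = lifted.p.dim {x - y | x y. x \<in> L \<and> y \<in> L}"

definition spheres_of ::
  "('a::field ^ 'n \<Rightarrow> 'a) \<Rightarrow> (('a ^ 'n) \<times> 'a) set \<Rightarrow> ('a, 'n) sphere_param set" where
  "spheres_of Q L = sphere_lift Q -` L"

definition base_locus ::
  "('a::field ^ 'n \<Rightarrow> 'a) \<Rightarrow> (('a ^ 'n) \<times> 'a) set \<Rightarrow> ('a ^ 'n) set" where
  "base_locus Q L = {x. \<forall>y\<in>L. lift_form Q x y = 0}"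

definition linear_functional_on :: "('a::field ^ 'n) set \<Rightarrow> ('a ^ 'n \<Rightarrow> 'a) \<Rightarrow> bool" where
  "linear_functional_on W \<beta> \<longleftrightarrow>
     (\<forall>v\<in>W. \<forall>w\<in>W. \<beta> (v + w) = \<beta> v + \<beta> w) \<and> (\<forall>c. \<forall>w\<in>W. \<beta> (c *s w) = c * \<beta> w)"

end

theory Submission
  imports Defs
begin

text \<open>A sphere contains \<open>x\<close> iff the affine form \<open>\<Lambda>\<^sub>x\<close> vanishes at its lift. By Markov's inequality most
  spheres are rich, i.e. miss at most \<open>\<theta> n\<close> points of \<open>P\<close>. Take for \<open>L\<close> the affine span of the lifts of
  the rich spheres and choose rich spheres lifting to an affine basis of \<open>L\<close>: a point on all of
  these at most \<open>d + 2\<close> spheres lies in \<open>B(L)\<close>, and a union bound counts the others. As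
  \<open>(d + 2) \<theta> < 1\<close>, some \<open>z \<in> B(L)\<close> exists. Then \<open>\<Lambda>\<^sub>z\<close> vanishes on \<open>L\<close>, so the direction of \<open>L\<close> is the
  graph of \<open>w \<mapsto> - \<langle>z, w\<rangle>\<close> over its projection \<open>W\<close>; this gives \<open>dim L \<le> d\<close> and the explicit model.
  Part (b) is part (a) for \<open>\<theta> = sqrt (\<mu> / (d + 1))\<close>, which balances the two losses.\<close>

text \<open>Translation by 1 permutes the field, so comparing the sum of all elements before and
  after it shows that the cardinality is 0 in the field. If 2 were 0, an odd cardinality would be 1
  there.\<close>

lemma two_neq_zero_of_odd_card:
  assumes "odd (CARD('a::{field,finite}))"
  shows "(2::'a) \<noteq> 0"
proof
  assume two: "(2::'a) = 0"
  have "bij (\<lambda>x::'a. x + 1)"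
    by (rule o_bij[of "\<lambda>x. x - 1"]) auto
  then have "(\<Sum>x\<in>(UNIV::'a set). x) = (\<Sum>x\<in>(UNIV::'a set). x + 1)"
    by (rule sum.reindex_bij_betw[symmetric])
  then have "of_nat (CARD('a)) = (0::'a)"
    by (simp add: sum.distrib)
  moreover obtain k where "CARD('a) = 2 * k + 1"
    using assms by (rule oddE)
  ultimately show False
    using two by simp
qed

section \<open>Bilinearity of the polar form and base loci of translates\<close>

lemma polar_commute: "polar Q x y = polar Q y x"
  by (simp add: polar_def add.commute diff_diff_eq)

context
  fixes Q :: "'a::field ^ 'n \<Rightarrow> 'a"
  assumes quadratic: "quadratic_form Q"
begin

lemma polar_add_right: "polar Q x (v + w) = polar Q x v + polar Q x w"
  using quadratic by (simp add: quadratic_form_def Vector_Spaces.linear_iff)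

lemma polar_scale_right: "polar Q x (c *s v) = c * polar Q x v"
  using quadratic by (simp add: quadratic_form_def Vector_Spaces.linear_iff)

lemma polar_zero_right: "polar Q x 0 = 0"
  using polar_scale_right[of x 0 0] by simp

lemma polar_uminus_right: "polar Q x (- v) = - polar Q x v"
  using polar_scale_right[of x "-1" v] by simp

lemma polar_add_left: "polar Q (v + w) x = polar Q v x + polar Q w x"
  by (simp add: polar_commute[of _ _ x] polar_add_right)

lemma polar_diff_left: "polar Q (v - w) x = polar Q v x - polar Q w x"
  using polar_add_left[of "v - w" w x] by (simp add: algebra_simps)

lemma quadratic_form_scale: "Q (c *s x) = c\<^sup>2 * Q x"
  using quadratic by (simp add: quadratic_form_def)

lemma quadratic_form_uminus: "Q (- x) = Q x"
  using quadratic_form_scale[of "-1" x] by simp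

text \<open>The form \<open>lift_form Q x\<close> is affine, and a step \<open>v\<close> lowers its
  value by \<open>polar Q x (fst v) + snd v\<close>.\<close>

lemma base_locus_translate:
  "base_locus Q ((+) y ` V) =
    {x. \<forall>v\<in>V. lift_form Q x y = polar Q x (fst v) + snd v}"
proof -
  have "lift_form Q x (y + v) = lift_form Q x y - (polar Q x (fst v) + snd v)" for x v
    by (cases y; cases v) (simp add: polar_add_right)
  then show ?thesis
    by (auto simp: base_locus_def)
qed

text \<open>Testing \<open>v = 0\<close> splits off the condition at \<open>y\<close>. The rest says
  that \<open>V\<close> lies in the graph of the functional
  \<open>w \<mapsto> - polar Q x w\<close>, the form on which all later graph arguments
  rest.\<close>

lemma base_locus_translate_subspace:
  assumes "0 \<in> V"
  shows "base_locus Q ((+) y ` V) =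
    {x. lift_form Q x y = 0 \<and> (\<forall>v\<in>V. snd v = - polar Q x (fst v))}"
proof -
  have "(\<forall>v\<in>V. lift_form Q x y = polar Q x (fst v) + snd v) \<longleftrightarrow>
      lift_form Q x y = 0 \<and> (\<forall>v\<in>V. polar Q x (fst v) + snd v = 0)" for x
    by (metis assms add_0_right fst_zero polar_zero_right snd_zero)
  moreover have "polar Q x (fst v) + snd v = 0 \<longleftrightarrow> snd v = - polar Q x (fst v)" for x v
    by (auto simp: eq_neg_iff_add_eq_0 add.commute)
  ultimately show ?thesis
    by (simp only: base_locus_translate)
qed

text \<open>That graph is a subspace, so it contains the span of \<open>B\<close> as soon as it
  contains \<open>B\<close>. The added 0 stands for the condition at \<open>y\<close>
  itself.\<close>

lemma base_locus_span:
  "base_locus Q ((+) y ` lifted.p.span B) = base_locus Q ((+) y ` insert 0 B)"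
proof -
  have "lifted.p.subspace {v. snd v = - polar Q x (fst v)}" for x
    by (rule lifted.p.subspaceI)
      (simp_all add: lifted.scale_def polar_zero_right polar_add_right polar_scale_right)
  then have "lifted.p.span B \<subseteq> {v. snd v = - polar Q x (fst v)}"
    if "\<forall>b\<in>B. snd b = - polar Q x (fst b)" for x
    using that by (intro lifted.p.span_minimal) auto
  then have "(\<forall>v\<in>lifted.p.span B. snd v = - polar Q x (fst v)) \<longleftrightarrow>
      (\<forall>b\<in>insert 0 B. snd b = - polar Q x (fst b))" for x
    by (auto simp: polar_zero_right lifted.p.span_base)
  then show ?thesis
    by (simp add: base_locus_translate_subspace lifted.p.span_zero del: image_insert)
qed

end

section \<open>Dimension and explicit model of a lifted subspace\<close>

lemma affine_dim_translate:
  fixes V :: "(('a::field ^ 'n) \<times> 'a) set"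
  assumes "lifted.p.subspace V"
  shows "affine_dim ((+) y ` V) = lifted.p.dim V"
proof -
  have "{a - b |a b. a \<in> (+) y ` V \<and> b \<in> (+) y ` V} = V"
  proof (intro equalityI subsetI)
    fix v assume "v \<in> {a - b |a b. a \<in> (+) y ` V \<and> b \<in> (+) y ` V}"
    then obtain a b where "a \<in> V" "b \<in> V" "v = (y + a) - (y + b)"
      by blast
    then show "v \<in> V"
      by (simp add: lifted.p.subspace_diff[OF assms])
  next
    fix v assume "v \<in> V"
    then have "v = (y + v) - (y + 0)" "y + v \<in> (+) y ` V" "y + 0 \<in> (+) y ` V"
      using lifted.p.subspace_0[OF assms] by (auto simp del: add_0_right)
    then show "v \<in> {a - b |a b. a \<in> (+) y ` V \<and> b \<in> (+) y ` V}"
      by blast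
  qed
  then show ?thesis
    by (simp add: affine_dim_def)
qed

text \<open>A base point makes \<open>V\<close> the graph of a linear functional, so \<open>fst\<close> is injective on it.\<close>

lemma dim_fst_image:
  fixes Q :: "'a::field ^ 'n \<Rightarrow> 'a"
  assumes "quadratic_form Q" "lifted.p.subspace V" "x \<in> base_locus Q ((+) y ` V)"
  shows "vec.dim (fst ` V) = lifted.p.dim V"
proof -
  interpret fst_pair: finite_dimensional_vector_space_pair_1
    lifted.scale "lifted.Basis_pair :: (('a ^ 'n) \<times> 'a) set" "(*s) :: 'a \<Rightarrow> 'a ^ 'n \<Rightarrow> 'a ^ 'n"
    by unfold_locales
  have "snd v = - polar Q x (fst v)" if "v \<in> V" for v
    using assms that
    by (simp add: base_locus_translate_subspace lifted.p.subspace_0)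
  then have "inj_on fst V"
    by (intro inj_onI prod_eqI) auto
  moreover have "lifted.p.span V = V"
    using assms(2) by (rule lifted.p.span_eq_iff[THEN iffD2])
  ultimately show ?thesis
    by (intro fst_pair.dim_image_eq lifted.linear_fst) (simp only:)
qed

context
  fixes Q :: "'a::field ^ 'n \<Rightarrow> 'a"
  assumes quadratic: "quadratic_form Q" and two: "(2::'a) \<noteq> 0"
begin

text \<open>Odd characteristic enters here: if 2 were 0, the division in \<open>polar\<close> would
  return 0.\<close>

lemma quadratic_form_add: "Q (x + y) = Q x + 2 * polar Q x y + Q y"
proof -
  have "2 * polar Q x y = Q (x + y) - Q x - Q y"
    using two nonzero_mult_div_cancel_left[of 2 "Q (x + y) - Q x - Q y"]
    by (simp add: polar_def times_divide_eq_right del: numeral_times_minus_swap right_diff_distrib_numeral)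
  then show ?thesis
    by simp
qed

lemma quadratic_form_diff: "Q (x - y) = Q x - 2 * polar Q x y + Q y"
  using quadratic_form_add[of x "- y"]
  by (simp add: polar_uminus_right[OF quadratic] quadratic_form_uminus[OF quadratic])

text \<open>In the expansion of \<open>Q (p - c) - r\<close> the cross term is linear in
  \<open>2 *s c\<close>, and \<open>Q c\<close> is absorbed by the last coordinate
  \<open>r - Q c\<close> of the lift. Incidence thus becomes an affine condition on the
  lift.\<close>

lemma mem_sphere_points_iff: "p \<in> sphere_points Q \<sigma> \<longleftrightarrow> lift_form Q p (sphere_lift Q \<sigma>) = 0"
  by (cases \<sigma>) (auto simp: quadratic_form_diff polar_scale_right[OF quadratic] algebra_simps)

text \<open>The witnesses are \<open>z = x\<close>, the projection \<open>W\<close> of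
  \<open>V\<close>, the functional \<open>\<beta> = - polar Q x\<close>, and the sphere
  \<open>(c\<^sub>0, r\<^sub>0)\<close> that lifts to \<open>y\<close>.\<close>

lemma lifted_subspace_model:
  assumes V: "lifted.p.subspace V" and x: "x \<in> base_locus Q ((+) y ` V)"
  shows "\<exists>c\<^sub>0 r\<^sub>0 W \<beta> z.
    vec.subspace W \<and> vec.dim W = affine_dim ((+) y ` V) \<and>
    linear_functional_on W \<beta> \<and>
    (\<forall>w\<in>W. polar Q z w = - \<beta> w) \<and>
    spheres_of Q ((+) y ` V) =
      {(c\<^sub>0 + (1 / 2) *s w, r\<^sub>0 + \<beta> w + polar Q c\<^sub>0 w + (1 / 4) * Q w) | w. w \<in> W} \<and>
    base_locus Q ((+) y ` V) = sphere_points Q (c\<^sub>0, r\<^sub>0) \<inter> (+) z ` perp Q W"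
proof -
  define W where "W = fst ` V"
  define \<beta> where "\<beta> w = - polar Q x w" for w
  define c\<^sub>0 where "c\<^sub>0 = (1 / 2) *s fst y"
  define r\<^sub>0 where "r\<^sub>0 = snd y + Q c\<^sub>0"
  have zero: "0 \<in> V"
    using V by (rule lifted.p.subspace_0)
  note locus = base_locus_translate_subspace[OF quadratic zero, of y]
  have "vec.subspace W"
    unfolding W_def using lifted.linear_fst V 
    by (rule module_hom.subspace_image[OF module_hom_iff_linear[THEN iffD2]])
  moreover have "vec.dim W = affine_dim ((+) y ` V)"
    using dim_fst_image[OF quadratic V x] by (simp add: W_def affine_dim_translate[OF V])
  moreover have "linear_functional_on W \<beta>"
    by (simp add: linear_functional_on_def \<beta>_def polar_add_right[OF quadratic]
        polar_scale_right[OF quadratic])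
  moreover have "\<forall>w\<in>W. polar Q x w = - \<beta> w"
    by (simp add: \<beta>_def)
  moreover have "spheres_of Q ((+) y ` V) =
      {(c\<^sub>0 + (1 / 2) *s w, r\<^sub>0 + \<beta> w + polar Q c\<^sub>0 w + (1 / 4) * Q w) | w. w \<in> W}"
  proof -
    \<comment> \<open>The point \<open>x\<close> of the base locus forces
      \<open>snd v = \<beta> (fst v)\<close> on \<open>V\<close>.\<close>
    have V_eq: "V = (\<lambda>w. (w, \<beta> w)) ` W"
      using x by (force simp: locus W_def \<beta>_def image_image prod_eq_iff image_iff)
    \<comment> \<open>The lift doubles centres, so moving by \<open>w\<close> in the lift moves the
      centre by half of \<open>w\<close>.\<close>
    have half: "2 *s c = fst y + w \<longleftrightarrow> c = c\<^sub>0 + (1 / 2) *s w" for c w :: "'a ^ 'n"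
      using two by (auto simp: c\<^sub>0_def vec_eq_iff field_simps)
    have Q_shift: "Q (c\<^sub>0 + (1 / 2) *s w) = Q c\<^sub>0 + polar Q c\<^sub>0 w + (1 / 4) * Q w" for w
    proof -
      have "(1 / 2 :: 'a)\<^sup>2 = 1 / 4"
        by (simp add: power2_eq_square)
      then show ?thesis
        using two by (simp add: quadratic_form_add polar_scale_right[OF quadratic]
            quadratic_form_scale[OF quadratic])
    qed
    have "(c, r) \<in> spheres_of Q ((+) y ` V) \<longleftrightarrow>
        (\<exists>w\<in>W. 2 *s c = fst y + w \<and> r - Q c = snd y + \<beta> w)" for c r
      by (cases y) (auto simp: spheres_of_def V_eq image_image image_iff)
    \<comment> \<open>Solving for the radius adds back \<open>Q\<close> at the shifted centre, which
      produces the polar term and the quarter of \<open>Q w\<close>.\<close>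
    moreover have "c = c\<^sub>0 + (1 / 2) *s w \<and> r - Q c = snd y + \<beta> w \<longleftrightarrow>
        c = c\<^sub>0 + (1 / 2) *s w \<and> r = r\<^sub>0 + \<beta> w + polar Q c\<^sub>0 w + (1 / 4) * Q w" for c r w
      by (auto simp: Q_shift r\<^sub>0_def algebra_simps)
    ultimately have "(c, r) \<in> spheres_of Q ((+) y ` V) \<longleftrightarrow>
        (\<exists>w\<in>W. c = c\<^sub>0 + (1 / 2) *s w \<and>
          r = r\<^sub>0 + \<beta> w + polar Q c\<^sub>0 w + (1 / 4) * Q w)" for c r
      by (simp only: half)
    then show ?thesis
      by auto
  qed
  moreover have "base_locus Q ((+) y ` V) = sphere_points Q (c\<^sub>0, r\<^sub>0) \<inter> (+) x ` perp Q W"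
  proof -
    have "sphere_lift Q (c\<^sub>0, r\<^sub>0) = y"
      using two by (simp add: c\<^sub>0_def r\<^sub>0_def prod_eq_iff)
    then have "p \<in> sphere_points Q (c\<^sub>0, r\<^sub>0) \<longleftrightarrow> lift_form Q p y = 0" for p
      by (simp only: mem_sphere_points_iff)
    \<comment> \<open>Orthogonality of \<open>p - x\<close> to \<open>W\<close> means that
      \<open>p\<close> and \<open>x\<close> induce the same functional on \<open>W\<close>, and the
      one induced by \<open>x\<close> already describes \<open>V\<close>.\<close>
    moreover have "p \<in> (+) x ` perp Q W \<longleftrightarrow> (\<forall>v\<in>V. snd v = - polar Q p (fst v))" for p
    proof -
      have "p \<in> (+) x ` perp Q W \<longleftrightarrow> p - x \<in> perp Q W"
        by (auto intro: image_eqI[of _ _ "p - x"])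
      also have "\<dots> \<longleftrightarrow> (\<forall>v\<in>V. polar Q p (fst v) = polar Q x (fst v))"
        by (simp add: perp_def W_def polar_diff_left[OF quadratic])
      also have "\<dots> \<longleftrightarrow> (\<forall>v\<in>V. snd v = - polar Q p (fst v))"
        using x by (auto simp: locus)
      finally show ?thesis .
    qed
    ultimately show ?thesis
      by (auto simp: locus)
  qed
  ultimately show ?thesis
    by blast
qed

end

section \<open>From rich spheres to the affine subspace\<close>

text \<open>The union bound is used twice. The ambient dimension d + 1 first allows d + 2 test
  spheres, and \<open>small\<close> leaves a point in the base locus. That point lowers the
  dimension to at most d, so d + 1 test spheres suffice for the final estimate. The bound
  \<open>m\<close> is kept general so that it may also be 0.\<close>

lemma exists_affine_subspace_of_rich_spheres:
  fixes Q :: "'a::{field, finite} ^ 'n::finite \<Rightarrow> 'a" and m :: real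
  assumes quadratic: "quadratic_form Q" and two: "(2::'a) \<noteq> 0"
    and "R \<noteq> {}"
    and missed: "\<And>\<sigma>. \<sigma> \<in> R \<Longrightarrow> real (card (P - sphere_points Q \<sigma>)) \<le> m"
    and small: "(real CARD('n) + 2) * m < real (card P)"
  obtains y V where "lifted.p.subspace V" "affine_dim ((+) y ` V) \<le> CARD('n)"
    "R \<subseteq> spheres_of Q ((+) y ` V)" "base_locus Q ((+) y ` V) \<noteq> {}"
    "real (card P) - (real CARD('n) + 1) * m \<le> real (card (P \<inter> base_locus Q ((+) y ` V)))"
proof -
  obtain \<sigma>\<^sub>0 where \<sigma>\<^sub>0: "\<sigma>\<^sub>0 \<in> R"
    using \<open>R \<noteq> {}\<close> by auto
  have m: "0 \<le> m"
    using missed[OF \<sigma>\<^sub>0] by linarith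
  define y where "y = sphere_lift Q \<sigma>\<^sub>0"
  \<comment> \<open>Extracting the basis from these differences, rather than from their span, makes
    \<open>y + v\<close> the lift of a sphere in \<open>R\<close> for every basis vector
    \<open>v\<close>.\<close>
  define A where "A = (\<lambda>\<sigma>. sphere_lift Q \<sigma> - y) ` R"
  obtain B where B: "B \<subseteq> A" "lifted.p.independent B" "A \<subseteq> lifted.p.span B"
      "card B = lifted.p.dim A"
    by (rule lifted.p.basis_exists)
  define V where "V = lifted.p.span B"
  have V: "lifted.p.subspace V"
    by (simp add: V_def)
  have dim_V: "lifted.p.dim V = card B"
    using B(2) by (simp add: V_def lifted.p.dim_eq_card_independent)
  let ?L = "(+) y ` V"
  have R: "R \<subseteq> spheres_of Q ?L"
  proof
    fix \<sigma> assume "\<sigma> \<in> R"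
    then have "sphere_lift Q \<sigma> - y \<in> V"
      using B(3) by (auto simp: A_def V_def)
    then have "y + (sphere_lift Q \<sigma> - y) \<in> ?L"
      by blast
    then show "\<sigma> \<in> spheres_of Q ?L"
      by (simp add: spheres_of_def)
  qed
  have bound: "real (card P) - (real (card B) + 1) * m \<le> real (card (P \<inter> base_locus Q ?L))"
  proof -
    let ?M = "\<lambda>v. {p \<in> P. lift_form Q p (y + v) \<noteq> 0}"
    have M: "real (card (?M v)) \<le> m" if "v \<in> insert 0 B" for v
    proof -
      have "\<forall>v\<in>insert 0 A. y + v \<in> sphere_lift Q ` R"
        using \<sigma>\<^sub>0 by (simp add: A_def y_def)
      then have "y + v \<in> sphere_lift Q ` R"
        using that B(1) by blast
      then obtain \<sigma> where \<sigma>: "\<sigma> \<in> R" "y + v = sphere_lift Q \<sigma>"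
        by blast
      then have "?M v = P - sphere_points Q \<sigma>"
        by (auto simp: mem_sphere_points_iff[OF quadratic two])
      then show ?thesis
        using missed[OF \<sigma>(1)] by simp
    qed
    \<comment> \<open>A point outside the base locus already fails at \<open>y\<close> or at
      \<open>y + b\<close> for some basis vector \<open>b\<close>.\<close>
    have "P - base_locus Q ?L = (\<Union>v\<in>insert 0 B. ?M v)"
      unfolding V_def base_locus_span[OF quadratic] by (auto simp: base_locus_def)
    then have "card (P - base_locus Q ?L) \<le> (\<Sum>v\<in>insert 0 B. card (?M v))"
      using card_UN_le[of "insert 0 B" ?M] by simp
    then have "real (card (P - base_locus Q ?L)) \<le> (\<Sum>v\<in>insert 0 B. real (card (?M v)))"
      by (simp only: of_nat_sum[symmetric] of_nat_le_iff)
    also have "\<dots> \<le> real (card (insert 0 B)) * m"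
      using M by (rule sum_bounded_above)
    also have "\<dots> \<le> (real (card B) + 1) * m"
      using m by (intro mult_right_mono) (auto simp: card_insert_if)
    finally have "real (card (P - base_locus Q ?L)) \<le> (real (card B) + 1) * m" .
    moreover have "real (card P) = real (card (P \<inter> base_locus Q ?L)) + real (card (P - base_locus Q ?L))"
      by (metis card_Int_Diff finite of_nat_add)
    ultimately show ?thesis
      by linarith
  qed
  \<comment> \<open>Crude bound by the dimension of the whole lifted space, enough to obtain a base
    point.\<close>
  have "lifted.p.dim V \<le> CARD('n) + 1"
    using lifted.p.dim_subset_UNIV[of V] 
    by (simp add: lifted.dimension_pair vec.dimension_def card_cart_basis dimension_eq_1)
  then have "(real (card B) + 1) * m \<le> (real CARD('n) + 2) * m"
    using m by (intro mult_right_mono) (auto simp: dim_V)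
  then have ne: "base_locus Q ?L \<noteq> {}"
    using bound small by auto
  then obtain x where "x \<in> base_locus Q ?L"
    by blast
  \<comment> \<open>With a base point, \<open>fst\<close> preserves the dimension of
    \<open>V\<close>, and its image lies in a space of dimension d.\<close>
  then have dim_le: "card B \<le> CARD('n)"
    using dim_fst_image[OF quadratic V, of x y] dim_V vec.dim_subset_UNIV[of "fst ` V"]
    by (simp add: vec.dimension_def card_cart_basis)
  then have "(real (card B) + 1) * m \<le> (real CARD('n) + 1) * m"
    using m by (intro mult_right_mono) auto
  then show thesis
    using that[of V y] V R ne bound dim_le dim_V by (simp add: affine_dim_translate)
qed

section \<open>Counting rich spheres\<close>

lemma incidences_eq_sum:
  fixes P :: "('a::{field, finite} ^ 'n::finite) set"
  shows "incidences Q P S = (\<Sum>\<sigma>\<in>S. card (P \<inter> sphere_points Q \<sigma>))"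
proof -
  have "{(p, \<sigma>) \<in> P \<times> S. p \<in> sphere_points Q \<sigma>} =
      prod.swap ` (SIGMA \<sigma>:S. P \<inter> sphere_points Q \<sigma>)"
    by auto
  then show ?thesis
    by (simp add: incidences_def card_image)
qed

text \<open>Since \<mu> is the density of non-incidences, the missed points over all spheres total
  \<mu> n s. Each sphere outside \<open>R\<close> accounts for at least \<theta> n of them.\<close>

lemma card_rich_spheres_ge:
  fixes P :: "('a::{field, finite} ^ 'n::finite) set" and \<theta> \<mu> :: real
  assumes "0 < \<theta>" "P \<noteq> {}" "S \<noteq> {}"
    and \<mu>: "\<mu> = 1 - real (incidences Q P S) / (real (card P) * real (card S))"
  defines "R \<equiv> {\<sigma> \<in> S. real (card (P - sphere_points Q \<sigma>)) \<le> \<theta> * real (card P)}"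
  shows "(1 - \<mu> / \<theta>) * real (card S) \<le> real (card R)"
proof -
  have pos: "0 < real (card P)" "0 < real (card S)"
    using assms(2,3) by (auto simp: card_gt_0_iff)
  have "card P = card (P \<inter> sphere_points Q \<sigma>) + card (P - sphere_points Q \<sigma>)" for \<sigma>
    by (simp add: card_Int_Diff)
  then have "(\<Sum>\<sigma>\<in>S. card P) = incidences Q P S + (\<Sum>\<sigma>\<in>S. card (P - sphere_points Q \<sigma>))"
    unfolding incidences_eq_sum sum.distrib[symmetric] by (intro sum.cong) auto
  then have "real (card S * card P) =
      real (incidences Q P S) + (\<Sum>\<sigma>\<in>S. real (card (P - sphere_points Q \<sigma>)))"
    by (metis sum_constant of_nat_id of_nat_add of_nat_sum)
  then have "real (card S) * real (card P) =
      real (incidences Q P S) + (\<Sum>\<sigma>\<in>S. real (card (P - sphere_points Q \<sigma>)))"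
    by simp
  moreover have "\<mu> * real (card P) * real (card S) =
      real (card S) * real (card P) - real (incidences Q P S)"
    using assms(2,3) by (simp add: \<mu> field_simps)
  ultimately have total:
    "(\<Sum>\<sigma>\<in>S. real (card (P - sphere_points Q \<sigma>))) = \<mu> * real (card P) * real (card S)"
    by linarith
  have "real (card (S - R)) * (\<theta> * real (card P)) \<le>
      (\<Sum>\<sigma>\<in>S - R. real (card (P - sphere_points Q \<sigma>)))"
    by (rule sum_bounded_below) (auto simp: R_def)
  also have "\<dots> \<le> (\<Sum>\<sigma>\<in>S. real (card (P - sphere_points Q \<sigma>)))"
    by (rule sum_mono2) auto
  finally have "real (card (S - R)) * \<theta> * real (card P) \<le> \<mu> * real (card S) * real (card P)"
    by (simp add: total mult_ac)
  then have "real (card (S - R)) * \<theta> \<le> \<mu> * real (card S)"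
    using pos by simp
  then have "real (card (S - R)) \<le> \<mu> / \<theta> * real (card S)"
    using \<open>0 < \<theta>\<close> by (simp add: field_simps)
  moreover have "real (card S) = real (card R) + real (card (S - R))"
    using card_Int_Diff[of S R] by (simp add: R_def Int_absorb1)
  ultimately show ?thesis
    by (simp only: left_diff_distrib mult_1)
qed

section \<open>Choice of the threshold and the three conclusions\<close>

theorem theorem2p8:
  fixes Q :: "'a::{field, finite} ^ 'n::finite \<Rightarrow> 'a"
    and P :: "('a ^ 'n) set"
    and S :: "('a, 'n) sphere_param set"
    and \<mu> :: real
  assumes "odd (CARD('a))"
    and "CARD('n) \<ge> 2"
    and "quadratic_form Q" and "nondegenerate Q"
    and "P \<noteq> {}" and "S \<noteq> {}"
    and "\<mu> = 1 - real (incidences Q P S) / (real (card P) * real (card S))"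
  shows
    "(\<forall>\<theta>::real. 0 < \<theta> \<and> \<theta> < 1 / (real CARD('n) + 2) \<and> \<mu> < \<theta> \<longrightarrow>
        (\<exists>L P\<^sub>0 S\<^sub>0.
           affine_subspace L \<and> affine_dim L \<le> CARD('n) \<and>
           P\<^sub>0 \<subseteq> P \<and> S\<^sub>0 \<subseteq> S \<and>
           P\<^sub>0 \<subseteq> base_locus Q L \<and>
           real (card P\<^sub>0) \<ge> (1 - (real CARD('n) + 1) * \<theta>) * real (card P) \<and>
           S\<^sub>0 \<subseteq> spheres_of Q L \<and>
           real (card S\<^sub>0) \<ge> (1 - \<mu> / \<theta>) * real (card S) \<and>
           (\<forall>p\<in>P\<^sub>0. \<forall>\<sigma>\<in>S\<^sub>0. p \<in> sphere_points Q \<sigma>) \<and>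
           (\<exists>c\<^sub>0 r\<^sub>0 W \<beta> z.
              vec.subspace W \<and> vec.dim W = affine_dim L \<and>
              linear_functional_on W \<beta> \<and>
              (\<forall>w\<in>W. polar Q z w = - \<beta> w) \<and>
              spheres_of Q L =
                {(c\<^sub>0 + (1 / 2) *s w, r\<^sub>0 + \<beta> w + polar Q c\<^sub>0 w + (1 / 4) * Q w) | w. w \<in> W} \<and>
              base_locus Q L = sphere_points Q (c\<^sub>0, r\<^sub>0) \<inter> (+) z ` perp Q W)))
     \<and>
     (\<forall>\<delta>::real. 0 < \<mu> \<and> \<mu> < (real CARD('n) + 1) / (real CARD('n) + 2)\<^sup>2 \<and>
          \<delta> = sqrt ((real CARD('n) + 1) * \<mu>) \<longrightarrow>
        (\<exists>L P\<^sub>0 S\<^sub>0.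
           affine_subspace L \<and> affine_dim L \<le> CARD('n) \<and>
           P\<^sub>0 \<subseteq> P \<inter> base_locus Q L \<and> S\<^sub>0 \<subseteq> S \<inter> spheres_of Q L \<and>
           real (card P\<^sub>0) \<ge> (1 - \<delta>) * real (card P) \<and>
           real (card S\<^sub>0) \<ge> (1 - \<delta>) * real (card S)))
     \<and>
     (\<mu> = 0 \<longrightarrow>
        (\<exists>L P\<^sub>0 S\<^sub>0.
           affine_subspace L \<and> affine_dim L \<le> CARD('n) \<and>
           P\<^sub>0 = P \<and> S\<^sub>0 = S \<and>
           P\<^sub>0 \<subseteq> P \<inter> base_locus Q L \<and> S\<^sub>0 \<subseteq> S \<inter> spheres_of Q L \<and>
           real (card P\<^sub>0) \<ge> (1 - 0) * real (card P) \<and>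
           real (card S\<^sub>0) \<ge> (1 - 0) * real (card S)))"
proof -
  note quadratic = \<open>quadratic_form Q\<close>
  have two: "(2::'a) \<noteq> 0"
    using \<open>odd (CARD('a))\<close> by (rule two_neq_zero_of_odd_card)
  define d n s where "d = real CARD('n)" and "n = real (card P)" and "s = real (card S)"
  have d: "0 \<le> d" and n: "0 < n" and s: "0 < s"
    using \<open>P \<noteq> {}\<close> \<open>S \<noteq> {}\<close> by (auto simp: d_def n_def s_def card_gt_0_iff)
  \<comment> \<open>The core of (a), shared with (b). The subspace is kept as a translate with
    nonempty base locus, as the explicit model requires.\<close>
  have a: "\<exists>y V P\<^sub>0 S\<^sub>0. lifted.p.subspace V \<and> affine_dim ((+) y ` V) \<le> CARD('n) \<and>
      P\<^sub>0 \<subseteq> P \<and> S\<^sub>0 \<subseteq> S \<and> P\<^sub>0 \<subseteq> base_locus Q ((+) y ` V) \<and> base_locus Q ((+) y ` V) \<noteq> {} \<and>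
      (1 - (d + 1) * \<theta>) * n \<le> real (card P\<^sub>0) \<and> S\<^sub>0 \<subseteq> spheres_of Q ((+) y ` V) \<and>
      (1 - \<mu> / \<theta>) * s \<le> real (card S\<^sub>0)"
    if "0 < \<theta>" "\<theta> < 1 / (d + 2)" "\<mu> < \<theta>" for \<theta>
  proof -
    define R where "R = {\<sigma> \<in> S. real (card (P - sphere_points Q \<sigma>)) \<le> \<theta> * n}"
    have R: "(1 - \<mu> / \<theta>) * s \<le> real (card R)"
      unfolding R_def n_def s_def using that(1) assms(5-7) by (rule card_rich_spheres_ge)
    \<comment> \<open>The hypothesis \<mu> < \<theta> guarantees at least one rich sphere.\<close>
    have "0 < (1 - \<mu> / \<theta>) * s"
      using that s by simp
    then have "R \<noteq> {}"
      using R by auto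
    moreover have "real (card (P - sphere_points Q \<sigma>)) \<le> \<theta> * n" if "\<sigma> \<in> R" for \<sigma>
      using that by (simp add: R_def)
    moreover have "(real CARD('n) + 2) * (\<theta> * n) < real (card P)"
    proof -
      have "(d + 2) * \<theta> < 1"
        using that(2) d by (simp add: field_simps)
      then have "(d + 2) * \<theta> * n < 1 * n"
        using n by (intro mult_strict_right_mono)
      then show ?thesis
        by (simp add: d_def n_def mult.assoc)
    qed
    ultimately obtain y V where yV: "lifted.p.subspace V" "affine_dim ((+) y ` V) \<le> CARD('n)"
      "R \<subseteq> spheres_of Q ((+) y ` V)" "base_locus Q ((+) y ` V) \<noteq> {}"
      "real (card P) - (real CARD('n) + 1) * (\<theta> * n) \<le>
        real (card (P \<inter> base_locus Q ((+) y ` V)))"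
      by (rule exists_affine_subspace_of_rich_spheres[OF quadratic two])
    have "R \<subseteq> S"
      by (auto simp: R_def)
    moreover have "(1 - (d + 1) * \<theta>) * n \<le> real (card (P \<inter> base_locus Q ((+) y ` V)))"
      using yV(5) by (simp add: d_def n_def left_diff_distrib mult.assoc)
    ultimately show ?thesis
      using yV(1-4) R
      by (intro exI[of _ y] exI[of _ V] exI[of _ "P \<inter> base_locus Q ((+) y ` V)"] exI[of _ R] conjI) auto
  qed
  have affine: "affine_subspace ((+) y ` V)" if "lifted.p.subspace V"
    for y and V :: "(('a ^ 'n) \<times> 'a) set"
    using that unfolding affine_subspace_def by blast
  have incident: "p \<in> sphere_points Q \<sigma>" if "p \<in> base_locus Q L" "\<sigma> \<in> spheres_of Q L" for p \<sigma> L
    using that by (simp add: mem_sphere_points_iff[OF quadratic two] base_locus_def spheres_of_def)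
  show ?thesis
    unfolding d_def[symmetric] n_def[symmetric] s_def[symmetric]
  proof (intro conjI allI impI, goal_cases)
    case (1 \<theta>)
    then obtain y V P\<^sub>0 S\<^sub>0 where yV: "lifted.p.subspace V" "affine_dim ((+) y ` V) \<le> CARD('n)"
      "P\<^sub>0 \<subseteq> P" "S\<^sub>0 \<subseteq> S" "P\<^sub>0 \<subseteq> base_locus Q ((+) y ` V)" "base_locus Q ((+) y ` V) \<noteq> {}"
      "(1 - (d + 1) * \<theta>) * n \<le> real (card P\<^sub>0)" "S\<^sub>0 \<subseteq> spheres_of Q ((+) y ` V)"
      "(1 - \<mu> / \<theta>) * s \<le> real (card S\<^sub>0)"
      using a[of \<theta>] by blast
    obtain x where "x \<in> base_locus Q ((+) y ` V)"
      using yV(6) by blast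
    note model = lifted_subspace_model[OF quadratic two yV(1) this]
    have "\<forall>p\<in>P\<^sub>0. \<forall>\<sigma>\<in>S\<^sub>0. p \<in> sphere_points Q \<sigma>"
      using incident yV(5,8) by blast
    then show ?case
      by (intro exI[of _ "(+) y ` V"] exI[of _ P\<^sub>0] exI[of _ S\<^sub>0] conjI affine yV model)
  next
    case (2 \<delta>)
    \<comment> \<open>This choice solves (d + 1) \<theta> = \<mu> / \<theta>, and both sides equal
      \<delta>.\<close>
    define \<theta> where "\<theta> = \<delta> / (d + 1)"
    have \<delta>: "0 < \<delta>" "\<delta>\<^sup>2 = (d + 1) * \<mu>"
      using 2 d by simp_all
    \<comment> \<open>The upper bound on \<mu>, multiplied by d + 1, is the square of the inequality
      \<theta> < 1 / (d + 2) multiplied by d + 1.\<close>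
    have "\<delta>\<^sup>2 < ((d + 1) / (d + 2))\<^sup>2"
    proof -
      have "(d + 1) * \<mu> < (d + 1) * ((d + 1) / (d + 2)\<^sup>2)"
        using 2 d by (intro mult_strict_left_mono) auto
      then show ?thesis
        unfolding \<delta>(2) by (simp add: power_divide power2_eq_square)
    qed
    then have less: "\<delta> < (d + 1) / (d + 2)"
      by (rule power2_less_imp_less) (use d in simp)
    have \<mu>_eq: "\<mu> = \<delta> * \<theta>"
      using \<delta>(2) d by (simp add: \<theta>_def power2_eq_square field_simps)
    have pos: "0 < \<theta>"
      using \<delta>(1) d by (simp add: \<theta>_def)
    have "\<theta> < 1 / (d + 2)"
      using less d by (simp add: \<theta>_def field_simps)
    moreover have "\<mu> < \<theta>"
    proof -
      have "(d + 1) / (d + 2) < 1"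
        using d by simp
      then have "\<delta> < 1"
        using less by linarith
      then show ?thesis
        using pos by (simp add: \<mu>_eq)
    qed
    moreover have "\<mu> / \<theta> = \<delta>" "(d + 1) * \<theta> = \<delta>"
      using pos d by (simp_all add: \<mu>_eq \<theta>_def)
    ultimately obtain y V P\<^sub>0 S\<^sub>0 where yV: "lifted.p.subspace V"
      "affine_dim ((+) y ` V) \<le> CARD('n)"
      "P\<^sub>0 \<subseteq> P" "S\<^sub>0 \<subseteq> S" "P\<^sub>0 \<subseteq> base_locus Q ((+) y ` V)" "S\<^sub>0 \<subseteq> spheres_of Q ((+) y ` V)"
      "(1 - \<delta>) * n \<le> real (card P\<^sub>0)" "(1 - \<delta>) * s \<le> real (card S\<^sub>0)"
      using a[of \<theta>] pos by auto
    show ?case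
      by (intro exI[of _ "(+) y ` V"] exI[of _ P\<^sub>0] exI[of _ S\<^sub>0] conjI Int_greatest affine yV)
  next
    case 3
    \<comment> \<open>For \<mu> = 0 every pair is an incidence, so all of \<open>S\<close> is rich
      with \<open>m = 0\<close> and the existence lemma applies directly, without a
      threshold.\<close>
    have "real (incidences Q P S) = n * s"
      using 3 assms(7) n s by (simp add: n_def s_def field_simps)
    then have "incidences Q P S = card (P \<times> S)"
      by (metis card_cartesian_product n_def of_nat_eq_iff of_nat_mult s_def)
    then have "{(p, \<sigma>) \<in> P \<times> S. p \<in> sphere_points Q \<sigma>} = P \<times> S"
      unfolding incidences_def by (intro card_subset_eq) auto
    then have "real (card (P - sphere_points Q \<sigma>)) \<le> 0" if "\<sigma> \<in> S" for \<sigma>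
      using that by auto
    moreover have "(real CARD('n) + 2) * 0 < real (card P)"
      using n by (simp add: n_def)
    ultimately obtain y V where yV: "lifted.p.subspace V" "affine_dim ((+) y ` V) \<le> CARD('n)"
      "S \<subseteq> spheres_of Q ((+) y ` V)"
      "real (card P) - (real CARD('n) + 1) * 0 \<le> real (card (P \<inter> base_locus Q ((+) y ` V)))"
      by (rule exists_affine_subspace_of_rich_spheres[OF quadratic two \<open>S \<noteq> {}\<close>])
    \<comment> \<open>With \<open>m = 0\<close> the estimate loses no point, so the intersection is
      all of \<open>P\<close>.\<close>
    from yV(4) have "P \<inter> base_locus Q ((+) y ` V) = P"
      by (intro card_seteq) auto
    then have "P \<subseteq> base_locus Q ((+) y ` V)"
      by blast
    then show ?case
      by (intro exI[of _ "(+) y ` V"] exI[of _ P] exI[of _ S] conjI Int_greatest affine yV)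
        (simp_all add: n_def s_def)
  qed
qed

end
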